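(* Let $\alpha$ be irrational and $Tx=x+\alpha$ on $\mathbb{T}=\mathbb{R}/\mathbb{Z}$. Suppose that $\varphi:\mathbb{T}\to SU(2)$ is a $C^1$-cocycle over $T$ with degree $d(\varphi)\neq 0$. Then $\varphi$ is cohomologous to a diagonal cocycle, i.e. there are measurable maps $p:\mathbb{T}\to SU(2)$ and $\gamma:\mathbb{T}\to\{z\in\mathbb{C}:|z|=1\}$ such that $\varphi(x)=p(x)^{-1}\begin{pmatrix}\gamma(x)&0\\0&\overline{\gamma(x)}\end{pmatrix}p(Tx)$ for a.e. $x\in\mathbb{T}$.
   Context: A $C^1$-cocycle over $T$ is a $C^1$ function $\varphi:\mathbb{T}\to SU(2)$; for $n\ge 1$, $\varphi^{(n)}(x)=\varphi(x)\varphi(Tx)\cdots\varphi(T^{n-1}x)$. $D$ denotes differentiation in $x$, and $D\varphi^{(n)}(x)\,\varphi^{(n)}(x)^{-1}$ lies in the Lie algebra $\mathfrak{su}(2)$ of traceless skew-Hermitian $2\times 2$ matrices, normed by $\|A\|=\sqrt{\det A}$. The sequence $\frac1n D\varphi^{(n)}(\varphi^{(n)})^{-1}$ converges in $L^2(\mathbb{T},\mathfrak{su}(2))$ and Lebesgue-a.e. to some $\psi$ with $\|\psi(x)\|$ a.e. constant; the degree $d(\varphi)$ is this constant. Equivalently $d(\varphi)=\lim_n\frac1n\int_{\mathbb{T}}\|D\varphi^{(n)}(x)\varphi^{(n)}(x)^{-1}\|\,dx$. *)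

theory Defs
  imports "HOL-Analysis.Analysis" "HOL-Library.Periodic_Fun"
begin

text \<open>
  Functions on the circle \<open>\<real>/\<int>\<close> are represented by 1-periodic functions on \<open>\<real>\<close>
  (the library locale predicate \<open>periodic_fun_simple'\<close>). Under this identification the rotation is
  \<open>x \<mapsto> x + \<alpha>\<close>, differentiation on the circle is differentiation on \<open>\<real>\<close>, the
  integral over the circle is the integral over \<open>{0..1}\<close>, and, for periodic properties, almost
  everywhere on the circle means almost everywhere on \<open>\<real>\<close>.
\<close>

type_synonym cmat2 = "complex^2^2"

definition conj_transpose :: "cmat2 \<Rightarrow> cmat2" where
  "conj_transpose A = (\<chi> i j. cnj (A $ j $ i))"

definition SU2 :: "cmat2 set" where
  "SU2 = {A. conj_transpose A ** A = mat 1 \<and> A ** conj_transpose A = mat 1 \<and> det A = 1}"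

definition su2 :: "cmat2 set" where
  "su2 = {A. conj_transpose A = - A \<and> trace A = 0}"

text \<open>On \<^const>\<open>su2\<close> the determinant is real and nonnegative, so taking \<^const>\<open>Re\<close>
  only changes its type.\<close>

definition su2_norm :: "cmat2 \<Rightarrow> real" where
  "su2_norm A = sqrt (Re (det A))"

lemma su2_det:
  assumes "A \<in> su2"
  shows "det A = complex_of_real ((cmod (A $ 1 $ 1))\<^sup>2 + (cmod (A $ 1 $ 2))\<^sup>2)"
proof -
  have e: "cnj (A $ j $ i) = - (A $ i $ j)" for i j
  proof -
    have "conj_transpose A $ i $ j = (- A) $ i $ j"
      using assms by (simp only: su2_def mem_Collect_eq)
    then show ?thesis
      by (simp add: conj_transpose_def)
  qed
  have "A $ 1 $ 1 + A $ 2 $ 2 = 0"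
    using assms by (simp add: su2_def trace_def sum_2)
  then have t: "A $ 2 $ 2 = - (A $ 1 $ 1)"
    by (rule minus_unique[symmetric])
  have "complex_of_real ((cmod (A $ 1 $ 1))\<^sup>2) = - (A $ 1 $ 1 * A $ 1 $ 1)"
    by (subst complex_norm_square, subst e[of 1 1]) (rule mult_minus_right)
  moreover have "complex_of_real ((cmod (A $ 1 $ 2))\<^sup>2) = - (A $ 1 $ 2 * A $ 2 $ 1)"
    by (subst complex_norm_square, subst e[of 1 2]) (rule mult_minus_right)
  ultimately show ?thesis
    by (simp only: det_2 t of_real_add mult_minus_right) simp
qed

definition C1_cocycle :: "(real \<Rightarrow> cmat2) \<Rightarrow> bool" where
  "C1_cocycle \<phi> \<longleftrightarrow>
     periodic_fun_simple' \<phi> \<and> (\<forall>x. \<phi> x \<in> SU2) \<and> \<phi> C1_differentiable_on UNIV"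

primrec cocycle_iter :: "real \<Rightarrow> (real \<Rightarrow> cmat2) \<Rightarrow> nat \<Rightarrow> real \<Rightarrow> cmat2" where
  "cocycle_iter \<alpha> \<phi> 0 x = mat 1"
| "cocycle_iter \<alpha> \<phi> (Suc n) x = cocycle_iter \<alpha> \<phi> n x ** \<phi> (x + real n * \<alpha>)"

definition log_deriv_avg :: "real \<Rightarrow> (real \<Rightarrow> cmat2) \<Rightarrow> nat \<Rightarrow> real \<Rightarrow> cmat2" where
  "log_deriv_avg \<alpha> \<phi> n x =
     (1 / real n) *\<^sub>R
       (vector_derivative (cocycle_iter \<alpha> \<phi> n) (at x) ** matrix_inv (cocycle_iter \<alpha> \<phi> n x))"

text \<open>\<open>\<psi>\<close> is the limit of the averages both in \<open>L\<^sup>2\<close> of the circle with values in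
  \<^const>\<open>su2\<close> and almost everywhere.\<close>

definition is_log_deriv_limit ::
    "real \<Rightarrow> (real \<Rightarrow> cmat2) \<Rightarrow> (real \<Rightarrow> cmat2) \<Rightarrow> bool" where
  "is_log_deriv_limit \<alpha> \<phi> \<psi> \<longleftrightarrow>
     periodic_fun_simple' \<psi> \<and> (\<forall>x. \<psi> x \<in> su2) \<and> \<psi> \<in> borel_measurable borel \<and>
     set_integrable lborel {0..1} (\<lambda>x. (su2_norm (\<psi> x))\<^sup>2) \<and>
     (\<lambda>n. LINT x:{0..1}|lborel. (su2_norm (log_deriv_avg \<alpha> \<phi> n x - \<psi> x))\<^sup>2)
        \<longlonglongrightarrow> 0 \<and>
     (AE x in lborel. (\<lambda>n. log_deriv_avg \<alpha> \<phi> n x) \<longlonglongrightarrow> \<psi> x)"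

definition has_degree :: "real \<Rightarrow> (real \<Rightarrow> cmat2) \<Rightarrow> real \<Rightarrow> bool" where
  "has_degree \<alpha> \<phi> d \<longleftrightarrow>
     (\<exists>\<psi>. is_log_deriv_limit \<alpha> \<phi> \<psi> \<and> (AE x in lborel. su2_norm (\<psi> x) = d))"

text \<open>For a \<open>C\<^sup>1\<close>-cocycle over an irrational rotation such a constant always exists. As for
  the Bochner integral, the value 0 is used outside the domain of definition.\<close>

definition cocycle_degree :: "real \<Rightarrow> (real \<Rightarrow> cmat2) \<Rightarrow> real" where
  "cocycle_degree \<alpha> \<phi> =
     (if \<exists>d. has_degree \<alpha> \<phi> d then THE d. has_degree \<alpha> \<phi> d else 0)"

lemma has_degree_unique:
  assumes "has_degree \<alpha> \<phi> d" "has_degree \<alpha> \<phi> d'"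
  shows "d = d'"
proof -
  obtain \<psi> where 1: "AE x in lborel. (\<lambda>n. log_deriv_avg \<alpha> \<phi> n x) \<longlonglongrightarrow> \<psi> x"
      "AE x in lborel. su2_norm (\<psi> x) = d"
    using assms(1) unfolding has_degree_def is_log_deriv_limit_def by (elim exE conjE) rule
  obtain \<psi>' where 2: "AE x in lborel. (\<lambda>n. log_deriv_avg \<alpha> \<phi> n x) \<longlonglongrightarrow> \<psi>' x"
      "AE x in lborel. su2_norm (\<psi>' x) = d'"
    using assms(2) unfolding has_degree_def is_log_deriv_limit_def by (elim exE conjE) rule
  from 1 2 have "AE x in (lborel :: real measure). d = d'"
  proof eventually_elim
    case (elim x)
    from elim(1,3) have "\<psi> x = \<psi>' x"
      by (rule LIMSEQ_unique)
    with elim(2,4) show ?case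
      by simp
  qed
  then show ?thesis
    by (simp add: eventually_const_iff ae_filter_eq_bot_iff)
qed

lemma cocycle_degree_eq:
  assumes "has_degree \<alpha> \<phi> d"
  shows "cocycle_degree \<alpha> \<phi> = d"
proof -
  have "(THE d. has_degree \<alpha> \<phi> d) = d"
    using assms by (rule the_equality) (rule has_degree_unique[OF _ assms])
  with assms show ?thesis
    unfolding cocycle_degree_def by auto
qed

definition diag_cocycle :: "(real \<Rightarrow> complex) \<Rightarrow> real \<Rightarrow> cmat2" where
  "diag_cocycle \<gamma> x = vector [vector [\<gamma> x, 0], vector [0, cnj (\<gamma> x)]]"

end

theory Submission
  imports Defs
begin

text \<open>
  Differentiating \<open>\<phi>\<^sup>(\<^sup>n\<^sup>+\<^sup>1\<^sup>)(x) = \<phi>(x) \<phi>\<^sup>(\<^sup>n\<^sup>)(x + \<alpha>)\<close> and passing to the limit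
  shows that the limit \<open>\<psi>\<close> of the averaged logarithmic derivatives is equivariant:
  \<open>\<psi>(x) = \<phi>(x) \<psi>(x + \<alpha>) \<phi>(x)\<inverse>\<close> a.e. As the degree \<open>d\<close> is nonzero, \<open>\<psi>(x)\<close> has the
  distinct eigenvalues \<open>\<plusminus>i d\<close> and is diagonalised by some \<open>p(x)\<close> in \<open>SU(2)\<close> depending measurably
  on \<open>x\<close>. Then \<open>p(x) \<phi>(x) p(x + \<alpha>)\<inverse>\<close> commutes with \<open>diag(i d, -i d)\<close>, so it is diagonal.
\<close>

section \<open>Entrywise matrix algebra and the group SU(2)\<close>

lemma cmat2_eq_iff:
  "A = B \<longleftrightarrow> A $ 1 $ 1 = B $ 1 $ 1 \<and> A $ 1 $ 2 = B $ 1 $ 2 \<and>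
             A $ 2 $ 1 = B $ 2 $ 1 \<and> A $ 2 $ 2 = B $ 2 $ 2" for A B :: cmat2
  by (simp add: vec_eq_iff forall_2)

lemma matrix_mult_2_nth:
  "(A ** B) $ i $ j = A $ i $ 1 * B $ 1 $ j + A $ i $ 2 * B $ 2 $ j" for A B :: cmat2
  by (simp add: matrix_matrix_mult_def sum_2)

text \<open>In finite dimension bilinearity implies boundedness; this supplies the product rule and
  limits of matrix products.\<close>

lemma bounded_bilinear_cmat2_mult: "bounded_bilinear ((**) :: cmat2 \<Rightarrow> cmat2 \<Rightarrow> cmat2)"
  unfolding bilinear_conv_bounded_bilinear[symmetric] bilinear_def
  by (auto intro!: linearI simp: cmat2_eq_iff matrix_mult_2_nth scaleR_add_right algebra_simps)

lemma conj_transpose_mult: "conj_transpose (A ** B) = conj_transpose B ** conj_transpose A"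
  by (simp add: cmat2_eq_iff matrix_mult_2_nth conj_transpose_def mult.commute)

lemma SU2_conj_transpose:
  assumes "A \<in> SU2"
  shows "conj_transpose A \<in> SU2"
proof -
  have "conj_transpose (conj_transpose A) = A" "det (conj_transpose A) = cnj (det A)"
    by (simp_all add: cmat2_eq_iff conj_transpose_def det_2 mult.commute)
  with assms show ?thesis by (simp add: SU2_def)
qed

lemma SU2_cancel:
  assumes "A \<in> SU2"
  shows "conj_transpose A ** (A ** B) = B" "(B ** A) ** conj_transpose A = B"
proof -
  show "conj_transpose A ** (A ** B) = B"
    using assms by (simp add: SU2_def matrix_mul_assoc)
  show "(B ** A) ** conj_transpose A = B"
    using assms by (simp add: SU2_def flip: matrix_mul_assoc)
qed

lemma SU2_mult:
  assumes "A \<in> SU2" "B \<in> SU2"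
  shows "A ** B \<in> SU2"
proof -
  have "conj_transpose (A ** B) ** (A ** B) = conj_transpose B ** B"
    by (simp add: conj_transpose_mult SU2_cancel(1)[OF assms(1)] flip: matrix_mul_assoc)
  moreover have "(A ** B) ** conj_transpose (A ** B) = A ** conj_transpose A"
    by (simp add: conj_transpose_mult SU2_cancel(2)[OF assms(2)] matrix_mul_assoc)
  ultimately show ?thesis
    using assms by (simp add: SU2_def det_mul)
qed

lemma SU2_cancel':
  assumes "A \<in> SU2"
  shows "(B ** conj_transpose A) ** A = B"
  using assms by (simp add: SU2_def flip: matrix_mul_assoc)

text \<open>\<open>matrix_inv\<close> is a choice among two-sided inverses, so the content is their
  uniqueness.\<close>

lemma SU2_matrix_inv:
  assumes "A \<in> SU2"
  shows "matrix_inv A = conj_transpose A"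
  unfolding matrix_inv_def
proof (rule some_equality)
  fix X assume "A ** X = mat 1 \<and> X ** A = mat 1"
  then show "X = conj_transpose A"
    using SU2_cancel(1)[OF assms, of X] by simp
qed (use assms in \<open>simp add: SU2_def\<close>)

section \<open>Iterates of the cocycle and equivariance of the limit\<close>

lemma cocycle_iter_SU2:
  assumes "\<And>x. \<phi> x \<in> SU2"
  shows "cocycle_iter \<alpha> \<phi> n x \<in> SU2"
proof (induction n)
  case 0
  have "(mat 1 :: cmat2) \<in> SU2"
    by (simp add: SU2_def cmat2_eq_iff matrix_mult_2_nth conj_transpose_def mat_def det_2)
  then show ?case by simp
qed (simp add: SU2_mult assms)

text \<open>The recursion splits off the last factor; splitting off the first one relates the
  iterates at \<open>x\<close> to those at \<open>x + \<alpha>\<close>.\<close>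

lemma cocycle_iter_Suc_shift:
  "cocycle_iter \<alpha> \<phi> (Suc n) x = \<phi> x ** cocycle_iter \<alpha> \<phi> n (x + \<alpha>)"
  by (induction n) (simp_all add: algebra_simps matrix_mul_assoc)

lemma cocycle_iter_differentiable:
  assumes "\<And>x. \<phi> differentiable at x"
  shows "cocycle_iter \<alpha> \<phi> n differentiable at x"
proof (induction n)
  case 0
  have "cocycle_iter \<alpha> \<phi> 0 = (\<lambda>_. mat 1)" by auto
  then show ?case by simp
next
  case (Suc n)
  have "(\<lambda>x. \<phi> (x + real n * \<alpha>)) differentiable at x"
    using differentiable_compose[where f=\<phi> and g="\<lambda>x. x + real n * \<alpha>", OF assms] by simp
  with Suc have "(\<lambda>x. cocycle_iter \<alpha> \<phi> n x ** \<phi> (x + real n * \<alpha>)) differentiable at x"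
    unfolding differentiable_def
    using bounded_bilinear.FDERIV[OF bounded_bilinear_cmat2_mult] by blast
  moreover have "cocycle_iter \<alpha> \<phi> (Suc n) = (\<lambda>x. cocycle_iter \<alpha> \<phi> n x ** \<phi> (x + real n * \<alpha>))"
    by auto
  ultimately show ?case by simp
qed

text \<open>Product rule for \<phi>(x) times the shifted iterate. After multiplication by the
  inverse, the shifted iterate cancels in one term, and the other becomes a conjugate by
  \<phi>(x).\<close>

lemma log_deriv_avg_Suc:
  assumes SU: "\<And>x. \<phi> x \<in> SU2" and diff: "\<And>x. \<phi> differentiable at x"
  shows "log_deriv_avg \<alpha> \<phi> (Suc n) x =
    (1 / real (Suc n)) *\<^sub>R (vector_derivative \<phi> (at x) ** conj_transpose (\<phi> x)) +
    (real n / real (Suc n)) *\<^sub>R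
      ((\<phi> x ** log_deriv_avg \<alpha> \<phi> n (x + \<alpha>)) ** conj_transpose (\<phi> x))"
proof -
  interpret mult: bounded_bilinear "(**) :: cmat2 \<Rightarrow> cmat2 \<Rightarrow> cmat2"
    by (rule bounded_bilinear_cmat2_mult)
  let ?F = "cocycle_iter \<alpha> \<phi> n"
  let ?D = "\<lambda>g. vector_derivative g (at x)"
  let ?D' = "vector_derivative ?F (at (x + \<alpha>))"
  have iter_0: "cocycle_iter \<alpha> \<phi> 0 = (\<lambda>_. mat 1)" by auto
  note inv = SU2_matrix_inv[OF cocycle_iter_SU2[OF SU]]
  have 1: "(\<phi> has_vector_derivative ?D \<phi>) (at x)"
    using diff by (simp flip: vector_derivative_works)
  have "(?F has_vector_derivative ?D') (at (x + \<alpha>))"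
    using cocycle_iter_differentiable[OF diff] by (simp flip: vector_derivative_works)
  moreover have "((\<lambda>x. x + \<alpha>) has_vector_derivative 1) (at x)"
    by (auto intro!: derivative_eq_intros)
  ultimately have 2: "((\<lambda>x. ?F (x + \<alpha>)) has_vector_derivative ?D') (at x)"
    using vector_diff_chain_at[of "\<lambda>x. x + \<alpha>" 1 x ?F] by (simp add: o_def)
  have "((\<lambda>x. \<phi> x ** ?F (x + \<alpha>)) has_vector_derivative
      (\<phi> x ** ?D' + ?D \<phi> ** ?F (x + \<alpha>))) (at x)"
    by (rule mult.has_vector_derivative[OF 1 2])
  moreover have "cocycle_iter \<alpha> \<phi> (Suc n) = (\<lambda>x. \<phi> x ** ?F (x + \<alpha>))"
    using cocycle_iter_Suc_shift by blast
  ultimately have D: "?D (cocycle_iter \<alpha> \<phi> (Suc n)) = \<phi> x ** ?D' + ?D \<phi> ** ?F (x + \<alpha>)"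
    by (simp only: vector_derivative_at)
  have "?D (cocycle_iter \<alpha> \<phi> (Suc n)) ** conj_transpose (cocycle_iter \<alpha> \<phi> (Suc n) x) =
      ?D \<phi> ** conj_transpose (\<phi> x) +
      \<phi> x ** (?D' ** conj_transpose (?F (x + \<alpha>))) ** conj_transpose (\<phi> x)"
    unfolding D cocycle_iter_Suc_shift conj_transpose_mult mult.add_left
    by (simp add: matrix_mul_assoc SU2_cancel(2) cocycle_iter_SU2[OF SU])
  then show ?thesis
    unfolding log_deriv_avg_def inv
    \<comment> \<open>For \<open>n = 0\<close> the factors \<open>real n\<close> and
      \<open>1 / real n\<close> do not cancel; there the derivative of the constant iterate vanishes
      instead.\<close>
    by (cases "n = 0") (simp_all add: iter_0 mult.scaleR_left mult.scaleR_right scaleR_add_right)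
qed

text \<open>Translations preserve null sets. As \<open>P\<close> need not be measurable, the affine
  rule is applied to a null set containing the exceptional points.\<close>

lemma AE_lborel_shift:
  assumes "AE x in lborel. P x"
  shows "AE x in lborel. P (x + a :: real)"
proof -
  from assms obtain N where N: "{x. \<not> P x} \<subseteq> N" "N \<in> null_sets lborel"
    by (auto simp: eventually_ae_filter)
  then have "AE x in lborel. x \<notin> N" by (rule_tac AE_not_in) simp
  moreover have [measurable]: "N \<in> sets borel" using N by auto
  ultimately have "AE x in lborel. a + 1 * x \<notin> N"
    by (intro AE_borel_affine[of 1 "\<lambda>x. x \<notin> N"]) auto
  then show ?thesis
    by eventually_elim (use N in \<open>auto simp: add.commute\<close>)
qed

text \<open>In \<open>log_deriv_avg_Suc\<close> the first weight tends to 0 and the second to 1, so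
  the claim follows from uniqueness of limits.\<close>

lemma log_deriv_limit_equivariant:
  assumes SU: "\<And>x. \<phi> x \<in> SU2" and diff: "\<And>x. \<phi> differentiable at x"
    and lim: "AE x in lborel. (\<lambda>n. log_deriv_avg \<alpha> \<phi> n x) \<longlonglongrightarrow> \<psi> x"
  shows "AE x in lborel. \<psi> x = (\<phi> x ** \<psi> (x + \<alpha>)) ** conj_transpose (\<phi> x)"
  using lim AE_lborel_shift[OF lim, of \<alpha>]
proof eventually_elim
  case (elim x)
  interpret mult: bounded_bilinear "(**) :: cmat2 \<Rightarrow> cmat2 \<Rightarrow> cmat2"
    by (rule bounded_bilinear_cmat2_mult)
  have "(\<lambda>n. 1 / real (Suc n)) \<longlonglongrightarrow> 0" "(\<lambda>n. real n / real (Suc n)) \<longlonglongrightarrow> 1"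
    using LIMSEQ_inverse_real_of_nat LIMSEQ_n_over_Suc_n
    by (simp_all add: inverse_eq_divide)
  then have "(\<lambda>n. log_deriv_avg \<alpha> \<phi> (Suc n) x) \<longlonglongrightarrow>
      0 *\<^sub>R (vector_derivative \<phi> (at x) ** conj_transpose (\<phi> x)) +
      1 *\<^sub>R ((\<phi> x ** \<psi> (x + \<alpha>)) ** conj_transpose (\<phi> x))"
    unfolding log_deriv_avg_Suc[OF SU diff]
    by (intro tendsto_intros mult.tendsto elim(2))
  then show ?case
    using LIMSEQ_unique[OF LIMSEQ_Suc[OF elim(1)]] by simp
qed

section \<open>Measurable diagonalisation of su(2)\<close>

definition SU2_of_row :: "complex \<times> complex \<Rightarrow> cmat2" where
  "SU2_of_row v = vector [vector [fst v, snd v], vector [- cnj (snd v), cnj (fst v)]]"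

lemma SU2_of_row_nth [simp]:
  "SU2_of_row v $ 1 $ 1 = fst v" "SU2_of_row v $ 1 $ 2 = snd v"
  "SU2_of_row v $ 2 $ 1 = - cnj (snd v)" "SU2_of_row v $ 2 $ 2 = cnj (fst v)"
  by (simp_all add: SU2_of_row_def)

text \<open>The second row is orthogonal to the first and makes the determinant equal to the squared
  norm of \<open>v\<close>. Choosing a diagonalising matrix thus reduces to choosing a unit
  eigenvector.\<close>

lemma SU2_of_row_in_SU2:
  assumes "norm v = 1"
  shows "SU2_of_row v \<in> SU2"
proof -
  have "(cmod (fst v))\<^sup>2 + (cmod (snd v))\<^sup>2 = 1"
    using assms by (cases v) (simp add: norm_Pair)
  then have "fst v * cnj (fst v) + snd v * cnj (snd v) = 1"
    by (metis complex_norm_square of_real_1 of_real_add)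
  then show ?thesis
    by (simp add: SU2_def cmat2_eq_iff matrix_mult_2_nth conj_transpose_def mat_def det_2
        algebra_simps)
qed

lemma borel_measurable_SU2_of_row [measurable]: "SU2_of_row \<in> borel_measurable borel"
proof (rule borel_measurable_continuous_onI)
  have "continuous_on UNIV (\<lambda>v. SU2_of_row v $ i $ j)" for i j
    using exhaust_2[of i] exhaust_2[of j] by (elim disjE; simp; intro continuous_intros)
  then have "continuous_on UNIV (\<lambda>v. \<chi> i j. SU2_of_row v $ i $ j)"
    by (intro continuous_on_vec_lambda)
  then show "continuous_on UNIV SU2_of_row" by simp
qed

text \<open>For \<open>A\<close> in \<open>su(2)\<close> with norm \<open>d\<close> this is a left eigenvector for the eigenvalue \<open>i d\<close>. The
  formula \<open>(i d - A\<^sub>2\<^sub>2, A\<^sub>1\<^sub>2)\<close> degenerates exactly at \<open>A = diag(-i d, i d)\<close>.\<close>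

definition eigenrow :: "real \<Rightarrow> cmat2 \<Rightarrow> complex \<times> complex" where
  "eigenrow d A =
     (let v = (\<i> * of_real d - A $ 2 $ 2, A $ 1 $ 2) in if v = 0 then (0, 1) else sgn v)"

lemma norm_eigenrow: "norm (eigenrow d A) = 1"
  by (simp add: eigenrow_def Let_def norm_sgn norm_Pair)

lemma borel_measurable_eigenrow:
  assumes [measurable]: "f \<in> borel_measurable M"
  shows "(\<lambda>x. eigenrow d (f x)) \<in> borel_measurable M"
proof -
  have [measurable]: "(\<lambda>x. f x $ i $ j) \<in> borel_measurable M" for i j
    by (rule borel_measurable_continuous_on[OF _ assms]) (intro continuous_intros)
  have [measurable]: "(sgn :: complex \<times> complex \<Rightarrow> _) \<in> borel_measurable borel"
    unfolding sgn_div_norm by measurable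
  show ?thesis
    unfolding eigenrow_def Let_def by measurable
qed

lemma su2_nth:
  assumes "A \<in> su2"
  shows "A $ 1 $ 1 = - A $ 2 $ 2" "cnj (A $ i $ j) = - A $ j $ i"
proof -
  show "A $ 1 $ 1 = - A $ 2 $ 2"
    using assms by (auto simp: su2_def trace_def sum_2 eq_neg_iff_add_eq_0)
  have "conj_transpose A $ j $ i = (- A) $ j $ i"
    using assms by (simp only: su2_def mem_Collect_eq)
  then show "cnj (A $ i $ j) = - A $ j $ i"
    by (simp add: conj_transpose_def)
qed

text \<open>As A has trace 0 and determinant d^2, Cayley-Hamilton gives (A + i d)(A - i d) = A^2 +
  d^2 = 0. Hence the rows of A + i d are left eigenvectors for i d, and \<open>?w\<close> is the
  first of them.\<close>

lemma eigenrow_left_eigenvector: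
  assumes A: "A \<in> su2" and d: "su2_norm A = d"
  defines "v \<equiv> eigenrow d A"
  shows "fst v * A $ 1 $ 1 + snd v * A $ 2 $ 1 = \<i> * of_real d * fst v"
    "fst v * A $ 1 $ 2 + snd v * A $ 2 $ 2 = \<i> * of_real d * snd v"
proof -
  note nth = su2_nth[OF A]
  let ?w = "(\<i> * of_real d - A $ 2 $ 2, A $ 1 $ 2)"
  \<comment> \<open>The determinant is real and nonnegative, so squaring \<open>su2_norm A\<close>
    recovers it.\<close>
  have "Re (det A) \<ge> 0" "det A = of_real (Re (det A))"
    by (simp_all add: su2_det[OF A])
  then have "det A = (of_real d)\<^sup>2"
    unfolding d[symmetric] su2_norm_def by (metis of_real_power real_sqrt_pow2)
  then have det: "A $ 1 $ 2 * A $ 2 $ 1 = - (A $ 2 $ 2)\<^sup>2 - (of_real d)\<^sup>2"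
    by (simp add: det_2 nth(1) power2_eq_square algebra_simps)
  have i: "\<i> * (\<i> * z) = - z" for z
    by (simp flip: mult.assoc)
  have "(fst v * A $ 1 $ 1 + snd v * A $ 2 $ 1 = \<i> * of_real d * fst v) \<and>
    (fst v * A $ 1 $ 2 + snd v * A $ 2 $ 2 = \<i> * of_real d * snd v)"
  proof (cases "?w = 0")
    case True
    then have "A $ 1 $ 2 = 0" "A $ 2 $ 2 = \<i> * of_real d" "v = (0, 1)"
      by (auto simp: v_def eigenrow_def zero_prod_def)
    moreover from this have "A $ 2 $ 1 = 0"
      using nth(2)[of 1 2] by simp
    ultimately show ?thesis by simp
  next
    case False
    then have v: "v = sgn ?w" by (simp add: v_def eigenrow_def)
    have "fst ?w * A $ 1 $ 1 + snd ?w * A $ 2 $ 1 = \<i> * of_real d * fst ?w"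
      "fst ?w * A $ 1 $ 2 + snd ?w * A $ 2 $ 2 = \<i> * of_real d * snd ?w"
      unfolding fst_conv snd_conv det nth(1) by (simp_all add: algebra_simps power2_eq_square i)
    then show ?thesis
      unfolding v sgn_div_norm fst_scaleR snd_scaleR mult_scaleR_left mult_scaleR_right
        scaleR_add_right[symmetric] by simp
  qed
  then show "fst v * A $ 1 $ 1 + snd v * A $ 2 $ 1 = \<i> * of_real d * fst v"
    "fst v * A $ 1 $ 2 + snd v * A $ 2 $ 2 = \<i> * of_real d * snd v"
    by blast+
qed

text \<open>Since A is skew-Hermitian, conjugating the eigenvector equations makes the conjugate of
  \<open>?v\<close> a right eigenvector for i d. By trace 0 this says that the second row is a left
  eigenvector for -i d.\<close>

lemma SU2_of_eigenrow_diagonalizes: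
  assumes A: "A \<in> su2" and d: "su2_norm A = d"
  shows "SU2_of_row (eigenrow d A) ** A =
    diag_cocycle (\<lambda>_. \<i> * of_real d) x ** SU2_of_row (eigenrow d A)"
proof -
  note e = eigenrow_left_eigenvector[OF A d]
  let ?v = "eigenrow d A"
  have "cnj (fst ?v * A $ 1 $ 1 + snd ?v * A $ 2 $ 1) = cnj (\<i> * of_real d * fst ?v)"
    "cnj (fst ?v * A $ 1 $ 2 + snd ?v * A $ 2 $ 2) = cnj (\<i> * of_real d * snd ?v)"
    by (simp_all only: e)
  then have "cnj (fst ?v) * A $ 1 $ 1 + cnj (snd ?v) * A $ 1 $ 2 = \<i> * of_real d * cnj (fst ?v)"
    "cnj (fst ?v) * A $ 2 $ 1 + cnj (snd ?v) * A $ 2 $ 2 = \<i> * of_real d * cnj (snd ?v)"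
    by (simp_all add: su2_nth(2)[OF A] algebra_simps)
  then show ?thesis
    using e su2_nth(1)[OF A]
    by (simp add: cmat2_eq_iff matrix_mult_2_nth diag_cocycle_def algebra_simps)
qed

text \<open>The off-diagonal entries of the commutator are those of \<open>M\<close> times -2 i d or
  2 i d, so they vanish. Unitarity and determinant 1 then fix the diagonal.\<close>

lemma SU2_commuting_diag:
  assumes M: "M \<in> SU2" and "d \<noteq> 0"
    and comm: "M ** diag_cocycle (\<lambda>_. \<i> * of_real d) x = diag_cocycle (\<lambda>_. \<i> * of_real d) x ** M"
  shows "M = diag_cocycle (\<lambda>_. M $ 1 $ 1) x" "cmod (M $ 1 $ 1) = 1"
proof -
  have 0: "M $ 1 $ 2 = 0" "M $ 2 $ 1 = 0"
    using comm \<open>d \<noteq> 0\<close> by (auto simp: cmat2_eq_iff matrix_mult_2_nth diag_cocycle_def)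
  have 1: "M $ 1 $ 1 * M $ 2 $ 2 = 1" "M $ 1 $ 1 * cnj (M $ 1 $ 1) = 1"
    using M 0 by (auto simp: SU2_def det_2 cmat2_eq_iff matrix_mult_2_nth conj_transpose_def mat_def)
  then have "M $ 2 $ 2 = cnj (M $ 1 $ 1)"
    by (metis mult_cancel_left mult_zero_left zero_neq_one)
  with 0 show "M = diag_cocycle (\<lambda>_. M $ 1 $ 1) x"
    by (simp add: cmat2_eq_iff diag_cocycle_def)
  show "cmod (M $ 1 $ 1) = 1"
    using 1(2) by (metis complex_mod_sqrt_Re_mult_cnj one_complex.sel(1) real_sqrt_one)
qed

section \<open>Construction of the transfer map and the diagonal cocycle\<close>

theorem theorem2p4:
  fixes \<alpha> :: real and \<phi> :: "real \<Rightarrow> complex^2^2"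
  assumes "\<alpha> \<notin> \<rat>"
    and "C1_cocycle \<phi>"
    and "cocycle_degree \<alpha> \<phi> \<noteq> 0"
  shows "\<exists>(p :: real \<Rightarrow> complex^2^2) (\<gamma> :: real \<Rightarrow> complex).
           periodic_fun_simple' p \<and> p \<in> borel_measurable borel \<and> (\<forall>x. p x \<in> SU2) \<and>
           periodic_fun_simple' \<gamma> \<and> \<gamma> \<in> borel_measurable borel \<and> (\<forall>x. cmod (\<gamma> x) = 1) \<and>
           (AE x in lborel. \<phi> x = matrix_inv (p x) ** diag_cocycle \<gamma> x ** p (x + \<alpha>))"
proof -
  from assms(2) have SU: "\<And>x. \<phi> x \<in> SU2" and diff: "\<And>x. \<phi> differentiable at x"
    and per: "\<And>x. \<phi> (x + 1) = \<phi> x"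
    by (auto simp: C1_cocycle_def C1_differentiable_on_eq periodic_fun_simple'_def)
  \<comment> \<open>\<open>cocycle_degree\<close> defaults to 0, so a nonzero value guarantees that
    a degree exists.\<close>
  obtain d where d: "has_degree \<alpha> \<phi> d"
    using assms(3) by (auto simp: cocycle_degree_def split: if_splits)
  with assms(3) have "d \<noteq> 0" by (simp add: cocycle_degree_eq)
  from d obtain \<psi> where \<psi>: "periodic_fun_simple' \<psi>" "\<And>x. \<psi> x \<in> su2"
    and [measurable]: "\<psi> \<in> borel_measurable borel"
    and lim: "AE x in lborel. (\<lambda>n. log_deriv_avg \<alpha> \<phi> n x) \<longlonglongrightarrow> \<psi> x"
    and norm: "AE x in lborel. su2_norm (\<psi> x) = d"
    by (auto simp: has_degree_def is_log_deriv_limit_def)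
  define p where "p x = SU2_of_row (eigenrow d (\<psi> x))" for x
  define M where "M x = (p x ** \<phi> x) ** conj_transpose (p (x + \<alpha>))" for x
  \<comment> \<open>\<open>M\<close> is shown to be diagonal only almost everywhere; the default 1
    keeps \<gamma> unimodular at every point.\<close>
  define \<gamma> where "\<gamma> x = (if cmod (M x $ 1 $ 1) = 1 then M x $ 1 $ 1 else 1)" for x
  have pSU: "p x \<in> SU2" for x
    by (simp add: p_def SU2_of_row_in_SU2 norm_eigenrow)
  have p_per: "p (x + 1) = p x" for x
    using \<psi>(1) by (simp add: p_def periodic_fun_simple'_def)
  have M_per: "M (x + 1) = M x" for x
    using p_per[of "x + \<alpha>"] by (simp add: M_def p_per per add.assoc add.commute[of 1 \<alpha>])
  have p_meas [measurable]: "p \<in> borel_measurable borel"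
    unfolding p_def
    by (rule measurable_compose[OF borel_measurable_eigenrow borel_measurable_SU2_of_row]) simp
  have [measurable]: "\<phi> \<in> borel_measurable borel"
    by (auto intro!: borel_measurable_continuous_onI differentiable_imp_continuous_on
        simp: differentiable_on_def differentiable_at_withinI diff)
  have nth: "(\<lambda>x. f x $ i $ j) \<in> borel_measurable borel" if "f \<in> borel_measurable borel"
    for f :: "real \<Rightarrow> cmat2" and i j
    by (rule borel_measurable_continuous_on[OF _ that]) (intro continuous_intros)
  have [measurable]: "(\<lambda>x. p x $ i $ j) \<in> borel_measurable borel"
    "(\<lambda>x. p (x + \<alpha>) $ i $ j) \<in> borel_measurable borel"
    "(\<lambda>x. \<phi> x $ i $ j) \<in> borel_measurable borel" for i j
    by (rule nth; measurable)+
  have [measurable]: "cnj \<in> borel_measurable borel"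
    by (intro borel_measurable_continuous_onI continuous_on_cnj[OF continuous_on_id])
  have [measurable]: "(\<lambda>x. M x $ 1 $ 1) \<in> borel_measurable borel"
    unfolding M_def matrix_mult_2_nth conj_transpose_def vec_lambda_beta by measurable
  have \<gamma>_meas: "\<gamma> \<in> borel_measurable borel"
    unfolding \<gamma>_def by measurable
  have "AE x in lborel. \<phi> x = matrix_inv (p x) ** diag_cocycle \<gamma> x ** p (x + \<alpha>)"
    using log_deriv_limit_equivariant[OF SU diff lim] norm AE_lborel_shift[OF norm, of \<alpha>]
  proof eventually_elim
    case (elim x)
    let ?D = "diag_cocycle (\<lambda>_. \<i> * of_real d) x"
    have D1: "p x ** \<psi> x = ?D ** p x"
      unfolding p_def using \<psi>(2) elim(2) by (rule SU2_of_eigenrow_diagonalizes)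
    have D2: "p (x + \<alpha>) ** \<psi> (x + \<alpha>) = ?D ** p (x + \<alpha>)"
      unfolding p_def using \<psi>(2) elim(3) by (rule SU2_of_eigenrow_diagonalizes)
    have MSU: "M x \<in> SU2"
      by (simp add: M_def SU2_mult SU2_conj_transpose pSU SU)
    have Mp: "M x ** p (x + \<alpha>) = p x ** \<phi> x"
      by (simp add: M_def SU2_cancel' pSU)
    have "\<phi> x ** \<psi> (x + \<alpha>) = \<psi> x ** \<phi> x"
      by (subst elim(1)) (simp add: SU2_cancel' SU)
    \<comment> \<open>With q and \<psi>' the values of p and \<psi> at \<open>x + \<alpha>\<close>,
      the chain is M D q = M q \<psi>' = p \<phi> \<psi>' = p \<psi> \<phi> = D p \<phi> = D M
      q.\<close>
    then have "(M x ** ?D) ** p (x + \<alpha>) = (?D ** M x) ** p (x + \<alpha>)"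
      using D1 D2 Mp by (metis matrix_mul_assoc)
    then have "M x ** ?D = ?D ** M x"
      by (metis SU2_cancel(2) pSU)
    from SU2_commuting_diag[OF MSU \<open>d \<noteq> 0\<close> this]
    have "M x = diag_cocycle \<gamma> x"
      by (simp add: diag_cocycle_def \<gamma>_def)
    then show ?case
      using Mp pSU by (metis SU2_cancel(1) SU2_matrix_inv matrix_mul_assoc)
  qed
  then show ?thesis
    using pSU p_per M_per p_meas \<gamma>_meas
    by (intro exI[of _ p] exI[of _ \<gamma>]) (auto simp: periodic_fun_simple'_def \<gamma>_def)
qed

end
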